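(* For every $M\in\mathbb N$, the probability that $\frac{a}{M}$, with $a\in\mathbb Z$ and $\gcd(a,M)=1$, has finite order equals $1$; that is, $$\sum_{n=0}^{\infty}\frac{A(n,M)}{\varphi(M^{n+1})}=1.$$
   Context: Let $\chi:\mathbb Q\to\mathbb Q$ be defined by $\chi(x)=x\lceil x\rceil$, where $\lceil x\rceil$ is the smallest integer greater than or equal to $x$. For $x\in\mathbb Q$, $\mathrm{ord}(x)=\min\{k\in\mathbb N_0:\chi^k(x)\in\mathbb Z\}$ if this set is nonempty, and $\mathrm{ord}(x)=\infty$ otherwise ($\mathbb N=\{1,2,\dots\}$, $\mathbb N_0=\mathbb N\cup\{0\}$). For $n\in\mathbb N_0$ and $M\in\mathbb N$, let $\mathcal A_{n,M}=\{a\in\mathbb Z:\gcd(a,M)=1,\ \mathrm{ord}(a/M)=n\}$; this set is a union of congruence classes modulo $M^{n+1}$, and $A(n,M)$ denotes the number of congruence classes modulo $M^{n+1}$ contained in $\mathcal A_{n,M}$. Thus $A(n,M)/\varphi(M^{n+1})$ is the proportion of residue classes modulo $M^{n+1}$ coprime to $M$ whose elements $a$ satisfy $\mathrm{ord}(a/M)=n$, interpreted as the probability that $a/M$ (with $\gcd(a,M)=1$) has order $n$. $\varphi$ is Euler's totient function. *)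

theory Defs
  imports Complex_Main "HOL-Library.Extended_Nat" "HOL-Number_Theory.Number_Theory"
begin

definition chi :: "rat \<Rightarrow> rat" where
  "chi x = x * of_int \<lceil>x\<rceil>"

definition chi_ord :: "rat \<Rightarrow> enat" where
  "chi_ord x = (if \<exists>k. (chi ^^ k) x \<in> \<int> then enat (LEAST k. (chi ^^ k) x \<in> \<int>) else \<infinity>)"

definition ord_set :: "nat \<Rightarrow> nat \<Rightarrow> int set" where
  "ord_set n M = {a. coprime a (int M) \<and> chi_ord (of_int a / of_nat M) = enat n}"

definition cong_class :: "nat \<Rightarrow> int \<Rightarrow> int set" where
  "cong_class m r = {b. [b = r] (mod int m)}"

definition class_count :: "nat \<Rightarrow> nat \<Rightarrow> nat" where
  "class_count n M = card {C \<in> range (cong_class (M ^ (n + 1))). C \<subseteq> ord_set n M}"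

end

theory Submission
  imports Defs
begin

text \<open>Write \<open>a = c M - s\<close> with \<open>c = \<lceil>a/M\<rceil>\<close> and \<open>0 \<le> s < M\<close>, and let \<open>c = g e\<close>, \<open>M = g d\<close> with
  \<open>g = gcd(c, M)\<close>. Then \<open>\<chi>(a/M) = e (g M e - s) / d\<close>. For \<open>s\<close> coprime to \<open>d\<close> the map
  \<open>e \<mapsto> e (g M e - s)\<close> permutes the residues modulo every power of \<open>d\<close>, so the new numerator is again
  uniformly distributed. The denominators thus form a Markov chain on the divisors of \<open>M\<close> that moves
  from \<open>M\<close> to \<open>d\<close> with probability \<open>\<phi>(d)/M\<close>. Since \<open>\<phi>(M)/M < 1\<close> for \<open>M > 1\<close>, it is absorbed at
  \<open>1\<close> almost surely.\<close>

section \<open>Counting residues in periodic sets\<close>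

definition periodic :: "nat \<Rightarrow> int set \<Rightarrow> bool" where
  "periodic m S \<longleftrightarrow> (\<forall>a b. [a = b] (mod int m) \<longrightarrow> a \<in> S \<longrightarrow> b \<in> S)"

definition residue_count :: "nat \<Rightarrow> int set \<Rightarrow> nat" where
  "residue_count m S = card (S \<inter> {0..<int m})"

lemma periodicI [intro?]:
  "(\<And>a b. [a = b] (mod int m) \<Longrightarrow> a \<in> S \<Longrightarrow> b \<in> S) \<Longrightarrow> periodic m S"
  unfolding periodic_def by blast

lemma periodic_cong_iff: "periodic m S \<Longrightarrow> [a = b] (mod int m) \<Longrightarrow> a \<in> S \<longleftrightarrow> b \<in> S"
  unfolding periodic_def using cong_sym by blast

lemma periodic_dvd: "periodic m S \<Longrightarrow> m dvd n \<Longrightarrow> periodic n S"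
  unfolding periodic_def using cong_dvd_modulus of_nat_dvd_iff by blast

lemma periodic_vimage:
  assumes "periodic m S" "\<And>a b. [a = b] (mod int m) \<Longrightarrow> [f a = f b] (mod int m)"
  shows "periodic m (f -` S)"
  using assms unfolding periodic_def vimage_def by blast

lemma cong_atLeastLessThan_imp_eq:
  fixes a b :: int
  shows "a \<in> {0..<int m} \<Longrightarrow> b \<in> {0..<int m} \<Longrightarrow> [a = b] (mod int m) \<Longrightarrow> a = b"
  using cong_less_imp_eq_int[of a "int m" b] by simp

lemma card_vimage_complete_residues:
  assumes periodic: "periodic m S" and "finite A" "card A = m"
    and inj_mod: "\<And>x y. x \<in> A \<Longrightarrow> y \<in> A \<Longrightarrow> [f x = f y] (mod int m) \<Longrightarrow> x = y"
  shows "card (f -` S \<inter> A) = residue_count m S"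
proof -
  let ?r = "\<lambda>x. f x mod int m"
  have inj: "inj_on ?r A"
    using inj_mod by (intro inj_onI) (simp add: cong_def)
  have range: "?r ` A = {0..<int m}"
  proof (rule card_subset_eq)
    show "?r ` A \<subseteq> {0..<int m}"
      using assms(2,3) card_gt_0_iff[of A] by auto
    show "card (?r ` A) = card {0..<int m}"
      using card_image[OF inj] assms(3) by simp
  qed simp
  have "?r x \<in> S \<longleftrightarrow> f x \<in> S" for x
    by (rule periodic_cong_iff[OF periodic]) (simp add: cong_def)
  then have "S \<inter> ?r ` A = ?r ` (f -` S \<inter> A)"
    by auto
  moreover have "inj_on ?r (f -` S \<inter> A)"
    using inj by (rule inj_on_subset) simp
  ultimately show ?thesis
    by (simp add: residue_count_def card_image flip: range)
qed

lemma residue_count_vimage: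
  assumes "periodic m S" "\<And>x y. [f x = f y] (mod int m) \<Longrightarrow> [x = y] (mod int m)"
  shows "residue_count m (f -` S) = residue_count m S"
  unfolding residue_count_def[of m "f -` S"]
  using assms(1)
  by (rule card_vimage_complete_residues) (use assms(2) cong_atLeastLessThan_imp_eq in auto)

lemma residue_count_coprime: "residue_count m {x. coprime x (int m)} = totient m"
proof -
  have "periodic m {x. coprime x (int m)}"
    by rule (use cong_imp_coprime in auto)
  moreover have "x = y" if "x \<in> {0<..m}" "y \<in> {0<..m}" "[int x = int y] (mod int m)" for x y
  proof -
    have "[int x - 1 = int y - 1] (mod int m)"
      using that(3) by (simp add: cong_diff)
    then have "int x - 1 = int y - 1"
      by (rule cong_atLeastLessThan_imp_eq[rotated 2]) (use that in auto)
    then show ?thesis by simp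
  qed
  ultimately have "residue_count m {x. coprime x (int m)} =
      card (int -` {x. coprime x (int m)} \<inter> {0<..m})"
    by (intro card_vimage_complete_residues[symmetric]) auto
  also have "int -` {x. coprime x (int m)} \<inter> {0<..m} = totatives m"
    by (auto simp: totatives_def)
  finally show ?thesis by (simp add: totient_def)
qed

lemma residue_count_sum_fibres:
  assumes "periodic (k * m) S"
  shows "residue_count (k * m) S =
    (\<Sum>s\<in>{0..<int m}. residue_count k ((\<lambda>c. c * int m - s) -` S))"
proof -
  let ?A = "{0..<int m} \<times> {0..<int k}" and ?f = "\<lambda>(s, c). c * int m - s"
  have inj: "x = y" if "x \<in> ?A" "y \<in> ?A" "[?f x = ?f y] (mod int (k * m))" for x y
  proof -
    obtain s c t b where xy: "x = (s, c)" "y = (t, b)" by fastforce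
    have mem: "s \<in> {0..<int m}" "c \<in> {0..<int k}" "t \<in> {0..<int m}" "b \<in> {0..<int k}"
      using that xy by auto
    have dvd_diff: "int k * int m dvd (c - b) * int m - (s - t)"
      using that xy by (simp add: cong_iff_dvd_diff algebra_simps)
    then have "int m dvd (c - b) * int m - (s - t)"
      using dvd_mult_right by blast
    then have "[s = t] (mod int m)"
      unfolding cong_iff_dvd_diff by (metis dvd_diff_right_iff dvd_triv_right)
    then have s_eq: "s = t"
      using mem cong_atLeastLessThan_imp_eq by blast
    then have "[c = b] (mod int k)"
      using dvd_diff mem by (simp add: cong_iff_dvd_diff)
    then have "c = b"
      using mem cong_atLeastLessThan_imp_eq by blast
    then show ?thesis using s_eq xy by simp
  qed
  have "residue_count (k * m) S = card (?f -` S \<inter> ?A)"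
    by (rule card_vimage_complete_residues[OF assms _ _ inj, symmetric])
      (simp_all add: card_cartesian_product)
  also have "?f -` S \<inter> ?A =
      (SIGMA s:{0..<int m}. (\<lambda>c. c * int m - s) -` S \<inter> {0..<int k})"
    by auto
  finally show ?thesis by (simp add: residue_count_def)
qed

lemma residue_count_mult:
  assumes "periodic m S"
  shows "residue_count (k * m) S = k * residue_count m S"
proof -
  have "(\<lambda>c. c * int m - s) -` S = (if - s \<in> S then UNIV else {})" for s
    using periodic_cong_iff[OF assms, of "_ * int m - s" "- s"]
    by (auto simp: cong_iff_dvd_diff)
  then have "residue_count k ((\<lambda>c. c * int m - s) -` S) = (if - s \<in> S then k else 0)" for s
    by (simp add: residue_count_def)
  then have "residue_count (k * m) S = (\<Sum>s\<in>{0..<int m}. if - s \<in> S then k else 0)"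
    using residue_count_sum_fibres[OF periodic_dvd[OF assms], of k] by simp
  also have "\<dots> = k * residue_count m (uminus -` S)"
    by (simp add: residue_count_def sum.If_cases vimage_def Int_commute)
  also have "residue_count m (uminus -` S) = residue_count m S"
    using assms by (rule residue_count_vimage) (simp add: cong_minus_minus_iff)
  finally show ?thesis .
qed

lemma gcd_div_mult_eq:
  fixes e :: int
  assumes "d dvd m" "coprime e (int d)"
  shows "gcd (int (m div d) * e) (int m) = int (m div d)"
proof -
  have "int m = int (m div d) * int d"
    using assms(1) by (simp flip: of_nat_mult)
  then have "gcd (int (m div d) * e) (int m) = int (m div d) * gcd e (int d)"
    by (simp only: gcd_mult_left) simp
  then show ?thesis using assms(2) by simp
qed

lemma gcd_cofactors_int:
  fixes c :: int
  assumes "m > 0"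
  obtains g d e where "m = g * d" "c = int g * e" "coprime e (int d)"
proof -
  define g where "g = nat (gcd c (int m))"
  have int_g: "int g = gcd c (int m)" by (simp add: g_def)
  then have "int g dvd int m" "int g dvd c" by simp_all
  then have "g dvd m" "int g dvd c" by (simp_all only: of_nat_dvd_iff)
  then obtain d e where cofactors: "m = g * d" "c = int g * e" by (elim dvdE)
  have "gcd (int g * e) (int g * int d) = int g"
    using int_g[symmetric] by (simp only: cofactors of_nat_mult)
  then have "int g * gcd e (int d) = int g"
    by (simp add: gcd_mult_left)
  moreover have "int g \<noteq> 0" using assms cofactors(1) by auto
  ultimately have "coprime e (int d)" by (simp add: coprime_iff_gcd_eq_1)
  then show ?thesis using cofactors that by blast
qed

lemma bij_betw_gcd_cofactors:
  assumes "m > 0"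
  shows "bij_betw (\<lambda>(d, e). int (m div d) * e) (SIGMA d:{d. d dvd m}. {e. coprime e (int d)}) UNIV"
    (is "bij_betw ?f ?A UNIV")
proof (rule bij_betw_imageI)
  show "inj_on ?f ?A"
  proof (rule inj_onI, clarify)
    fix d e d' e'
    assume dvd: "d dvd m" "d' dvd m" and coprime: "coprime e (int d)" "coprime e' (int d')"
      and eq: "int (m div d) * e = int (m div d') * e'"
    have "int (m div d) = int (m div d')"
      using gcd_div_mult_eq[OF dvd(1) coprime(1)] gcd_div_mult_eq[OF dvd(2) coprime(2)] eq by simp
    moreover have "(m div d) * d = (m div d') * d'" "m div d > 0"
      using dvd assms by (auto simp: dvd_div_eq_0_iff)
    ultimately show "d = d' \<and> e = e'" using eq by simp
  qed
  have "c \<in> ?f ` ?A" for c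
  proof -
    obtain g d e where cofactors: "m = g * d" "c = int g * e" "coprime e (int d)"
      using gcd_cofactors_int[OF assms] by blast
    then have "m div d = g" "d dvd m" using assms by auto
    then show ?thesis
      using cofactors by (intro image_eqI[of _ _ "(d, e)"]) auto
  qed
  then show "?f ` ?A = UNIV" by blast
qed

lemma residue_count_gcd_split:
  assumes "m > 0"
  shows "residue_count (m * k) S =
    (\<Sum>d | d dvd m. residue_count (d * k) {e. coprime e (int d) \<and> int (m div d) * e \<in> S})"
proof -
  let ?f = "\<lambda>(d, e). int (m div d) * e" and ?D = "{d. d dvd m}"
  let ?A = "SIGMA d:?D. {e. coprime e (int d)}"
  define E where "E d = {e. coprime e (int d) \<and> int (m div d) * e \<in> S} \<inter> {0..<int (d * k)}" for d
  have bounds: "int (m div d) * e \<in> {0..<int (m * k)} \<longleftrightarrow> e \<in> {0..<int (d * k)}"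
    if "d dvd m" for d e
  proof -
    define g where "g = m div d"
    have m_eq: "m = g * d" using that by (simp add: g_def)
    then have "int g > 0" using assms by (auto intro: Nat.gr0I)
    then show ?thesis
      unfolding g_def[symmetric] by (auto simp: m_eq zero_le_mult_iff mult.assoc)
  qed
  have "bij_betw ?f (?f -` X \<inter> ?A) X" for X
  proof (rule bij_betw_subset[OF bij_betw_gcd_cofactors[OF assms]])
    have "?f ` (?f -` X \<inter> ?A) = X \<inter> ?f ` ?A" by auto
    also have "?f ` ?A = UNIV"
      using bij_betw_gcd_cofactors[OF assms] by (rule bij_betw_imp_surj_on)
    finally show "?f ` (?f -` X \<inter> ?A) = X" by simp
  qed simp
  moreover have "?f -` (S \<inter> {0..<int (m * k)}) \<inter> ?A = (SIGMA d:?D. E d)"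
    using bounds by (auto simp only: E_def)
  ultimately have "bij_betw ?f (SIGMA d:?D. E d) (S \<inter> {0..<int (m * k)})"
    by metis
  then have "residue_count (m * k) S = card (SIGMA d:?D. E d)"
    unfolding residue_count_def by (rule bij_betw_same_card[symmetric])
  then show ?thesis
    using assms by (simp add: E_def residue_count_def)
qed

lemma card_cong_classes_subset:
  assumes "periodic m S" "m > 0"
  shows "card {C \<in> range (cong_class m). C \<subseteq> S} = residue_count m S"
proof -
  have class_eq_iff: "cong_class m x = cong_class m y \<longleftrightarrow> [x = y] (mod int m)" for x y
    unfolding cong_class_def by (auto simp: cong_def)
  have class_subset_iff: "cong_class m x \<subseteq> S \<longleftrightarrow> x \<in> S" for x
    using periodic_cong_iff[OF assms(1)] unfolding cong_class_def by (auto simp: cong_sym_eq)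
  have "{C \<in> range (cong_class m). C \<subseteq> S} = cong_class m ` (S \<inter> {0..<int m})"
  proof (intro equalityI subsetI)
    fix C assume "C \<in> {C \<in> range (cong_class m). C \<subseteq> S}"
    then obtain x where x: "C = cong_class m x" "x \<in> S" using class_subset_iff by auto
    have "[x = x mod int m] (mod int m)" by (simp add: cong_def)
    then have "C = cong_class m (x mod int m)" "x mod int m \<in> S"
      using x class_eq_iff periodic_cong_iff[OF assms(1)] by blast+
    then show "C \<in> cong_class m ` (S \<inter> {0..<int m})"
      using assms(2) by auto
  qed (use class_subset_iff in auto)
  moreover have "inj_on (cong_class m) (S \<inter> {0..<int m})"
    using class_eq_iff cong_atLeastLessThan_imp_eq by (intro inj_onI) blast
  ultimately show ?thesis by (simp add: card_image residue_count_def)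
qed

text \<open>The difference of two values of \<open>e \<mapsto> e (k e - s)\<close> is \<open>(e - e') (k (e + e') - s)\<close>, whose second
  factor is a unit modulo \<open>d\<close>.\<close>

lemma residue_count_quadratic_vimage:
  fixes k s :: int
  assumes "periodic (d ^ j) S" "int d dvd k" "coprime s (int d)"
  shows "residue_count (d ^ j) ((\<lambda>e. e * (k * e - s)) -` S) = residue_count (d ^ j) S"
  using assms(1)
proof (rule residue_count_vimage)
  fix x y :: int
  assume "[x * (k * x - s) = y * (k * y - s)] (mod int (d ^ j))"
  then have "int (d ^ j) dvd (x - y) * (k * (x + y) - s)"
    by (simp add: cong_iff_dvd_diff algebra_simps)
  moreover have "[- s = k * (x + y) - s] (mod int d)"
    using assms(2) by (simp add: cong_iff_dvd_diff)
  then have "coprime (k * (x + y) - s) (int d)"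
    using assms(3) cong_imp_coprime[of "- s"] by simp
  then have "coprime (int (d ^ j)) (k * (x + y) - s)"
    by (simp add: coprime_commute)
  ultimately show "[x = y] (mod int (d ^ j))"
    by (simp add: cong_iff_dvd_diff coprime_dvd_mult_left_iff)
qed

section \<open>One step of the iteration\<close>

lemma chi_ord_rec: "chi_ord x = (if x \<in> \<int> then 0 else eSuc (chi_ord (chi x)))"
proof (cases "x \<in> \<int>")
  case True
  then have "(chi ^^ 0) x \<in> \<int>" by simp
  moreover from this have "(LEAST k. (chi ^^ k) x \<in> \<int>) = 0"
    by (rule Least_eq_0)
  ultimately show ?thesis
    using True unfolding chi_ord_def zero_enat_def by metis
next
  case False
  then have not_0: "(chi ^^ 0) x \<notin> \<int>" by simp
  have shift: "(chi ^^ Suc k) x = (chi ^^ k) (chi x)" for k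
    by (simp add: funpow_Suc_right del: funpow.simps)
  have "(\<exists>k. (chi ^^ k) x \<in> \<int>) \<longleftrightarrow> (\<exists>k. (chi ^^ k) (chi x) \<in> \<int>)"
    using not_0 shift by (metis not0_implies_Suc)
  moreover have "(LEAST k. (chi ^^ k) x \<in> \<int>) = Suc (LEAST k. (chi ^^ k) (chi x) \<in> \<int>)"
    if "(chi ^^ k) x \<in> \<int>" for k
    using Least_Suc[of "\<lambda>k. (chi ^^ k) x \<in> \<int>", OF that not_0] unfolding shift .
  ultimately show ?thesis
    using False by (auto simp: chi_ord_def eSuc_enat)
qed

lemma coprime_fraction_in_Ints_iff:
  assumes "coprime a (int M)" "M > 0"
  shows "(of_int a / of_nat M :: rat) \<in> \<int> \<longleftrightarrow> M = 1"
  using of_int_div_of_int_in_Ints_iff[of a "int M", where ?'a = rat] assms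
  by (auto dest: coprime_common_divisor[of a "int M" "int M"])

lemma ord_set_zero: "M > 1 \<Longrightarrow> ord_set 0 M = {}"
  using coprime_fraction_in_Ints_iff
  by (auto simp: ord_set_def chi_ord_rec zero_enat_def[symmetric] split: if_splits)

lemma ord_set_one: "ord_set n 1 = (if n = 0 then UNIV else {})"
  by (auto simp: ord_set_def chi_ord_rec[of "of_int _"] zero_enat_def)

lemma chi_ceiling_decomposition:
  fixes e s :: int
  assumes "M = g * d" "M > 0" "0 \<le> s" "s < int M"
  shows "chi (of_int (int g * int M * e - s) / of_nat M) =
    of_int (e * (int g * int M * e - s)) / of_nat d"
proof -
  let ?a = "int g * int M * e - s"
  have "- ?a div int M = (s + (- (int g * e)) * int M) div int M"
    by (simp add: mult_ac)
  also have "\<dots> = - (int g * e)"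
    using assms(2-4) by (subst div_mult_self1) auto
  finally have "\<lceil>of_int ?a / of_nat M :: rat\<rceil> = int g * e"
    using ceiling_divide_eq_div[of ?a "int M", where ?'a = rat] by simp
  moreover have "g > 0" "d > 0"
    using assms(1,2) by (auto intro: Nat.gr0I)
  ultimately show ?thesis
    unfolding chi_def by (simp add: assms(1))
qed

lemma ord_set_Suc_iff:
  fixes e s :: int
  assumes M: "M = g * d" "M > 1" and s_bounds: "0 \<le> s" "s < int M" and coprime_e: "coprime e (int d)"
  shows "int g * int M * e - s \<in> ord_set (Suc n) M \<longleftrightarrow>
    coprime s (int M) \<and> e * (int g * int M * e - s) \<in> ord_set n d"
proof -
  define a where "a = int g * int M * e - s"
  have "[- s = a] (mod int M)" by (simp add: a_def cong_iff_dvd_diff)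
  then have coprime_iff: "coprime a (int M) \<longleftrightarrow> coprime s (int M)"
    using cong_imp_coprime cong_sym coprime_minus_left_iff by metis
  show ?thesis
  proof (cases "coprime a (int M)")
    case True
    then have "coprime (e * a) (int d)" using coprime_e M(1) by simp
    moreover have "chi_ord (of_int a / of_nat M) = eSuc (chi_ord (of_int (e * a) / of_nat d))"
      using chi_ceiling_decomposition[OF M(1) _ s_bounds, of e] M(2) coprime_fraction_in_Ints_iff[OF True]
      by (subst chi_ord_rec) (simp add: a_def)
    ultimately show ?thesis
      using True coprime_iff by (simp add: ord_set_def a_def[symmetric] flip: eSuc_enat)
  next
    case False
    then show ?thesis using coprime_iff by (simp add: ord_set_def a_def)
  qed
qed

lemma ceiling_gcd_decomposition:
  fixes a :: int
  assumes "M > 0"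
  obtains g d e s where "M = g * d" "0 \<le> s" "s < int M" "coprime e (int d)"
    "a = int g * int M * e - s"
proof -
  define s where "s = (- a) mod int M"
  obtain g d e where cofactors: "M = g * d" "- ((- a) div int M) = int g * e" "coprime e (int d)"
    using gcd_cofactors_int[OF assms] by blast
  have "- a = - (int g * e) * int M + s"
    unfolding cofactors(2)[symmetric] s_def by simp
  then have "a = int g * int M * e - s" by (simp add: mult_ac)
  moreover have "0 \<le> s" "s < int M" using assms by (auto simp: s_def)
  ultimately show ?thesis using cofactors that by blast
qed

lemma periodic_ord_set_Suc:
  assumes M: "M > 1" and periodic: "\<And>d. d dvd M \<Longrightarrow> periodic (d ^ (n + 1)) (ord_set n d)"
  shows "periodic (M ^ (Suc n + 1)) (ord_set (Suc n) M)"
proof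
  fix a b :: int
  assume a_cong_b: "[a = b] (mod int (M ^ (Suc n + 1)))" and a_in: "a \<in> ord_set (Suc n) M"
  have "M > 0" using M by simp
  then obtain g d e s where M_eq: "M = g * d" and s_bounds: "0 \<le> s" "s < int M"
    and coprime_e: "coprime e (int d)" and a_eq: "a = int g * int M * e - s"
    by (rule ceiling_gcd_decomposition)
  obtain t where b_shift: "b = a + int (M ^ (Suc n + 1)) * t"
    using a_cong_b by (auto simp: cong_iff_lin)
  define u where "u = e + int (d * M ^ n) * t"
  have "int (M ^ (Suc n + 1)) = int g * int M * int (d * M ^ n)"
    by (simp add: M_eq)
  then have b_eq: "b = int g * int M * u - s"
    by (simp add: b_shift a_eq u_def algebra_simps del: of_nat_power)
  have dvd_powers: "d ^ (n + 1) dvd d * M ^ n" "d ^ (n + 1) dvd M ^ (Suc n + 1)"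
    using dvd_power_same[of d M n] by (auto simp: M_eq intro!: mult_dvd_mono)
  have "[e = u] (mod int (d * M ^ n))"
    unfolding u_def cong_iff_lin by blast
  then have e_cong_u: "[e = u] (mod int (d ^ (n + 1)))"
    using dvd_powers(1) cong_dvd_modulus of_nat_dvd_iff by blast
  then have "[e = u] (mod int d)"
    by (rule cong_dvd_modulus) simp
  then have coprime_u: "coprime u (int d)"
    using coprime_e cong_imp_coprime by blast
  have "[a = b] (mod int (d ^ (n + 1)))"
    using a_cong_b dvd_powers(2) cong_dvd_modulus of_nat_dvd_iff by blast
  then have "[e * a = u * b] (mod int (d ^ (n + 1)))"
    using e_cong_u by (intro cong_mult)
  moreover have "periodic (d ^ (n + 1)) (ord_set n d)"
    using M_eq by (intro periodic) simp
  ultimately have "e * a \<in> ord_set n d \<longleftrightarrow> u * b \<in> ord_set n d"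
    by (rule periodic_cong_iff[rotated])
  then show "b \<in> ord_set (Suc n) M"
    using a_in ord_set_Suc_iff[OF M_eq M s_bounds coprime_e] ord_set_Suc_iff[OF M_eq M s_bounds coprime_u]
    unfolding a_eq b_eq by blast
qed

lemma periodic_ord_set:
  assumes "M > 0"
  shows "periodic (M ^ (n + 1)) (ord_set n M)"
  using assms
proof (induction n arbitrary: M)
  case 0
  then show ?case
    using ord_set_zero[of M] ord_set_one[of 0] by (cases "M = 1") (auto simp: periodic_def)
next
  case (Suc n)
  show ?case
  proof (cases "M = 1")
    case True
    then show ?thesis using ord_set_one[of "Suc n"] by (auto simp: periodic_def)
  next
    case False
    then show ?thesis
      using Suc by (intro periodic_ord_set_Suc) (auto intro: dvd_pos_nat)
  qed
qed

lemma class_count_eq_residue_count: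
  "M > 0 \<Longrightarrow> class_count n M = residue_count (M ^ (n + 1)) (ord_set n M)"
  unfolding class_count_def by (intro card_cong_classes_subset periodic_ord_set) auto

section \<open>The recurrence for the order distribution\<close>

lemma residue_count_chi_numerator:
  fixes s :: int
  assumes M: "M = g * d" "M > 0" and coprime_s: "coprime s (int M)"
  shows "residue_count (d * M ^ n) ((\<lambda>e. e * (int g * int M * e - s)) -` ord_set n d) =
    g ^ n * class_count n d"
proof -
  let ?E = "(\<lambda>e. e * (int g * int M * e - s)) -` ord_set n d"
  have d_pos: "d > 0" using M by (auto intro: Nat.gr0I)
  have "periodic (d ^ (n + 1)) ?E"
    by (intro periodic_vimage periodic_ord_set d_pos cong_mult cong_diff cong_refl)
  moreover have "d * M ^ n = g ^ n * d ^ (n + 1)"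
    by (simp add: M(1) power_mult_distrib)
  ultimately have "residue_count (d * M ^ n) ?E = g ^ n * residue_count (d ^ (n + 1)) ?E"
    by (metis residue_count_mult)
  also have "residue_count (d ^ (n + 1)) ?E = residue_count (d ^ (n + 1)) (ord_set n d)"
    using coprime_s by (intro residue_count_quadratic_vimage periodic_ord_set d_pos) (simp_all add: M(1))
  finally show ?thesis by (simp add: class_count_eq_residue_count[OF d_pos])
qed

lemma residue_count_ceiling_fibre:
  fixes s :: int
  assumes M: "M > 1" and s_bounds: "0 \<le> s" "s < int M"
  shows "residue_count (M * M ^ n) ((\<lambda>c. c * int M - s) -` ord_set (Suc n) M) =
    (if coprime s (int M) then \<Sum>d | d dvd M. (M div d) ^ n * class_count n d else 0)"
proof -
  let ?E = "\<lambda>d. {e. coprime e (int d) \<and> int (M div d) * e * int M - s \<in> ord_set (Suc n) M}"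
  have summand: "residue_count (d * M ^ n) (?E d) =
      (if coprime s (int M) then (M div d) ^ n * class_count n d else 0)" if "d dvd M" for d
  proof -
    define g where "g = M div d"
    have M_eq: "M = g * d" using that by (simp add: g_def)
    have coprime_e: "e * x \<in> ord_set n d \<Longrightarrow> coprime e (int d)" for e x
      by (simp add: ord_set_def)
    have swap: "int (M div d) * e * int M = int g * int M * e" for e
      by (simp add: g_def)
    have "?E d = (if coprime s (int M)
        then (\<lambda>e. e * (int g * int M * e - s)) -` ord_set n d else {})"
      unfolding swap using ord_set_Suc_iff[OF M_eq M s_bounds] coprime_e by auto
    then show ?thesis
      using residue_count_chi_numerator[OF M_eq] M unfolding g_def[symmetric]
      by (simp add: residue_count_def)
  qed
  have "M > 0" using M by simp
  then have "residue_count (M * M ^ n) ((\<lambda>c. c * int M - s) -` ord_set (Suc n) M) =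
      (\<Sum>d | d dvd M. residue_count (d * M ^ n) (?E d))"
    by (simp only: residue_count_gcd_split vimage_eq)
  also have "\<dots> = (\<Sum>d | d dvd M.
      if coprime s (int M) then (M div d) ^ n * class_count n d else 0)"
    by (intro sum.cong refl summand) simp
  finally show ?thesis by simp
qed

lemma class_count_Suc:
  assumes M: "M > 1"
  shows "class_count (Suc n) M = totient M * (\<Sum>d | d dvd M. (M div d) ^ n * class_count n d)"
    (is "_ = _ * ?N")
proof -
  have pow: "M ^ (Suc n + 1) = M * M ^ n * M" by simp
  have "M > 0" using M by simp
  then have "class_count (Suc n) M = residue_count (M * M ^ n * M) (ord_set (Suc n) M)"
    by (simp only: class_count_eq_residue_count pow)
  also have "\<dots> = (\<Sum>s\<in>{0..<int M}.
      residue_count (M * M ^ n) ((\<lambda>c. c * int M - s) -` ord_set (Suc n) M))"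
    using periodic_ord_set[OF \<open>M > 0\<close>, of "Suc n"] unfolding pow
    by (rule residue_count_sum_fibres)
  also have "\<dots> = (\<Sum>s\<in>{0..<int M}. if coprime s (int M) then ?N else 0)"
    by (intro sum.cong refl residue_count_ceiling_fibre[OF M]) auto
  also have "\<dots> = residue_count M {s. coprime s (int M)} * ?N"
    by (simp add: residue_count_def sum.If_cases Int_commute)
  finally show ?thesis by (simp add: residue_count_coprime)
qed

definition ord_density :: "nat \<Rightarrow> nat \<Rightarrow> real" where
  "ord_density n M = real (class_count n M) / real (totient (M ^ (n + 1)))"

lemma ord_density_nonneg: "ord_density n M \<ge> 0"
  by (simp add: ord_density_def)

lemma ord_density_zero: "M > 1 \<Longrightarrow> ord_density 0 M = 0"
  using class_count_eq_residue_count[of M 0]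
  by (simp add: ord_density_def ord_set_zero residue_count_def)

lemma ord_density_one: "ord_density n 1 = (if n = 0 then 1 else 0)"
  using class_count_eq_residue_count[of 1 n, unfolded ord_set_one]
  by (simp add: ord_density_def residue_count_def)

lemma ord_density_Suc:
  assumes "M > 1"
  shows "ord_density (Suc n) M = (\<Sum>d | d dvd M. real (totient d) / real M * ord_density n d)"
proof -
  have "ord_density (Suc n) M =
      (\<Sum>d | d dvd M. real ((M div d) ^ n * class_count n d)) / real M ^ Suc n"
    unfolding ord_density_def class_count_Suc[OF assms] Suc_eq_plus1[symmetric] totient_power_Suc
    using assms by simp
  also have "\<dots> = (\<Sum>d | d dvd M. real (totient d) / real M * ord_density n d)"
    unfolding sum_divide_distrib
  proof (intro sum.cong refl)
    fix d assume "d \<in> {d. d dvd M}"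
    then obtain g where M_eq: "M = d * g" by auto
    then have "d > 0" "g > 0" using assms by (auto intro: Nat.gr0I)
    then show "real ((M div d) ^ n * class_count n d) / real M ^ Suc n =
        real (totient d) / real M * ord_density n d"
      unfolding ord_density_def Suc_eq_plus1[symmetric] totient_power_Suc
      by (simp add: M_eq power_mult_distrib field_simps)
  qed
  finally show ?thesis .
qed

lemma sums_affine_recurrence:
  fixes p t :: "nat \<Rightarrow> real"
  assumes nonneg: "\<And>n. p n \<ge> 0" and "q < 1" and sums_t: "t sums T"
    and rec: "\<And>n. p (Suc n) = q * p n + t n"
  shows "p sums ((p 0 + T) / (1 - q))"
proof -
  have sum_Suc: "(\<Sum>i<Suc n. p i) = p 0 + q * (\<Sum>i<n. p i) + (\<Sum>i<n. t i)" for n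
    unfolding sum.lessThan_Suc_shift by (simp add: rec sum.distrib sum_distrib_left)
  have "convergent (\<lambda>n. \<Sum>i<n. t i)"
    using sums_t by (auto simp: sums_def convergent_def)
  then obtain B where bound: "\<And>n. norm (\<Sum>i<n. t i) \<le> B"
    using convergent_imp_Bseq BseqE by metis
  have "(\<Sum>i<n. p i) \<le> (p 0 + B) / (1 - q)" for n
  proof -
    have "(\<Sum>i<n. p i) \<le> p 0 + q * (\<Sum>i<n. p i) + (\<Sum>i<n. t i)"
      unfolding sum_Suc[symmetric] using nonneg by simp
    moreover have "(\<Sum>i<n. t i) \<le> B" using bound[of n] by simp
    ultimately have "(\<Sum>i<n. p i) * (1 - q) \<le> p 0 + B" by (simp add: algebra_simps)
    then show ?thesis using \<open>q < 1\<close> by (simp add: pos_le_divide_eq)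
  qed
  then have "summable p" using nonneg by (intro summableI_nonneg_bounded)
  then obtain L where sums_p: "p sums L" by (auto simp: summable_def)
  then have "(\<lambda>n. p (Suc n)) sums (L - p 0)" by (simp add: sums_Suc_iff)
  moreover have "(\<lambda>n. p (Suc n)) sums (q * L + T)"
    unfolding rec by (intro sums_add sums_mult sums_p sums_t)
  ultimately have "L - p 0 = q * L + T" by (rule sums_unique2)
  then have "L = (p 0 + T) / (1 - q)" using \<open>q < 1\<close> by (simp add: field_simps)
  then show ?thesis using sums_p by simp
qed

lemma ord_density_sums_one_if_proper_divisors:
  assumes M: "M > 1"
    and proper: "\<And>d. d dvd M \<Longrightarrow> d \<noteq> M \<Longrightarrow> (\<lambda>n. ord_density n d) sums 1"
  shows "(\<lambda>n. ord_density n M) sums 1"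
proof -
  define D where "D = {d. d dvd M \<and> d \<noteq> M}"
  define w where "w d = real (totient d) / real M" for d
  define t where "t n = (\<Sum>d\<in>D. w d * ord_density n d)" for n
  have divisors: "{d. d dvd M} = insert M D" "finite D" "M \<notin> D"
    using M by (auto simp: D_def)
  have "(\<Sum>d | d dvd M. w d) = real (\<Sum>d | d dvd M. totient d) / real M"
    by (simp add: w_def sum_divide_distrib)
  also have "\<dots> = 1"
    using M by (simp only: totient_divisor_sum) simp
  finally have sum_D: "(\<Sum>d\<in>D. w d * 1) = 1 - w M"
    using divisors by simp
  have sums_t: "t sums (1 - w M)"
    unfolding t_def sum_D[symmetric] using proper by (intro sums_sum sums_mult) (auto simp: D_def)
  have rec: "ord_density (Suc n) M = w M * ord_density n M + t n" for n
    using ord_density_Suc[OF M] divisors by (simp add: w_def t_def)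
  have "w M < 1"
    using totient_less[OF M] M by (simp add: w_def)
  then show ?thesis
    using sums_affine_recurrence[OF ord_density_nonneg _ sums_t rec] ord_density_zero[OF M] by simp
qed

theorem theorem3p1:
  fixes M :: nat
  assumes "M \<ge> 1"
  shows "(\<lambda>n. real (class_count n M) / real (totient (M ^ (n + 1)))) sums 1"
  unfolding ord_density_def[symmetric] using assms
proof (induction M rule: less_induct)
  case (less M)
  show ?case
  proof (cases "M = 1")
    case True
    show ?thesis
      unfolding True ord_density_one using sums_single[of 0 "\<lambda>_. 1 :: real"] by simp
  next
    case False
    then have M: "M > 1" using less.prems by simp
    then have "d < M \<and> d \<ge> 1" if "d dvd M" "d \<noteq> M" for d
      using that dvd_imp_le[of d M] by (auto intro: Nat.gr0I simp: Suc_le_eq)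
    then show ?thesis using less.IH ord_density_sums_one_if_proper_divisors[OF M] by blast
  qed
qed

end
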